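(* Let $V\subset\mathbb{R}^n$ be a compact set. Then \[\mathcal{C}^V_0\subseteq \mathcal{C}^V_1\subseteq\dots\subseteq \mathrm{COP}(V),\qquad Q^V_0\subseteq Q^V_1\subseteq\dots\subseteq \mathrm{COP}(V),\] and \[\operatorname{int}\mathrm{COP}(V)\subseteq \bigcup_{r\ge 0}\mathcal{C}^V_r\subseteq\bigcup_{r\ge 0}Q^V_r .\]
   Context: For a compact set $V$, $\mathcal{K}(V)$ denotes the set of kernels on $V$: continuous functions $F:V\times V\to\mathbb{R}$ with $F(x,y)=F(y,x)$ for all $x,y\in V$. For $K\in\mathcal{K}(V)$ and $U\subseteq V$, $K^U$ is the restriction of $K$ to $U\times U$ (for finite $U$ it is identified with a symmetric $|U|\times|U|$ matrix). A real symmetric matrix $M$ is copositive if $x^\top Mx\ge 0$ for all $x$ with nonnegative entries. $K\in\mathcal{K}(V)$ is PSD (resp. copositive) if for every finite $U\subset V$ the matrix $K^U$ is positive semidefinite (resp. copositive); $\mathrm{PSD}(V)$ and $\mathrm{COP}(V)$ denote the sets of PSD and of copositive kernels on $V$. $\operatorname{int}$ denotes the interior in $\mathcal{K}(V)$ with respect to the supremum norm. A tensor of order $r$ over $V$ is a function $V^r\to\mathbb{R}$ (not necessarily continuous); $\mathcal{T}^V_r$ is the set of these, and $\mathcal{N}^V_r$ is the set of those that are nonnegative everywhere. A kernel is regarded as a tensor of order $2$. For $r\ge 0$, the stack operator $\mathbf{Stk}^r:\mathcal{T}^V_d\to\mathcal{T}^V_{d+r}$ is $\mathbf{Stk}^r(T)(u,v)=T(u)$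 for $u\in V^d$, $v\in V^r$. The symmetrization $\sigma:\mathcal{T}^V_d\to\mathcal{T}^V_d$ is $\sigma(T)(v)=\frac{1}{d!}\sum_{\pi\in Sym(d)}T(\pi v)$, where $Sym(d)$ is the group of permutations of $d$ elements and $\pi v=(v_{\pi(1)},\dots,v_{\pi(d)})$. A tensor $F\in\mathcal{T}^V_{r+2}$ is 2-PSD on $V$ if it is continuous and for all $z\in V^r$, $F(\cdot,\cdot,z)\in\mathrm{PSD}(V)$. For an integer $r\ge 0$: $\mathcal{C}^V_r=\{M\in\mathcal{K}(V):\ \sigma(\mathbf{Stk}^r(M))=\sigma(N)\text{ for some }N\in\mathcal{N}^V_{r+2}\}$, and $Q^V_r=\{M\in\mathcal{K}(V):\ \sigma(\mathbf{Stk}^r(M))=\sigma(N)+\sigma(S)\text{ for some }N\in\mathcal{N}^V_{r+2}\text{ and some 2-PSD }S\in\mathcal{T}^V_{r+2}\}$. *)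

theory Defs
  imports "HOL-Analysis.Analysis"
begin

text \<open>
  Functions with domain \<open>D\<close> are represented by total functions that are \<^const>\<open>extensional\<close>
  on \<open>D\<close>, so that equality of represented functions is plain equality.
  A matrix with rows and columns indexed by a finite set \<open>U\<close> is a function on \<open>U \<times> U\<close>.
\<close>

definition symmetric_matrix :: "'i set \<Rightarrow> ('i \<times> 'i \<Rightarrow> real) \<Rightarrow> bool" where
  "symmetric_matrix U M \<longleftrightarrow> (\<forall>i\<in>U. \<forall>j\<in>U. M (i, j) = M (j, i))"

definition quadratic_form :: "'i set \<Rightarrow> ('i \<times> 'i \<Rightarrow> real) \<Rightarrow> ('i \<Rightarrow> real) \<Rightarrow> real" where
  "quadratic_form U M x = (\<Sum>i\<in>U. \<Sum>j\<in>U. x i * M (i, j) * x j)"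

definition psd_matrix :: "'i set \<Rightarrow> ('i \<times> 'i \<Rightarrow> real) \<Rightarrow> bool" where
  "psd_matrix U M \<longleftrightarrow> symmetric_matrix U M \<and> (\<forall>x. quadratic_form U M x \<ge> 0)"

definition copositive_matrix :: "'i set \<Rightarrow> ('i \<times> 'i \<Rightarrow> real) \<Rightarrow> bool" where
  "copositive_matrix U M \<longleftrightarrow>
     symmetric_matrix U M \<and> (\<forall>x. (\<forall>i\<in>U. x i \<ge> 0) \<longrightarrow> quadratic_form U M x \<ge> 0)"

definition kernels :: "'a::topological_space set \<Rightarrow> ('a \<times> 'a \<Rightarrow> real) set" where
  "kernels V = {F \<in> extensional (V \<times> V). continuous_on (V \<times> V) F \<and>
     (\<forall>x\<in>V. \<forall>y\<in>V. F (x, y) = F (y, x))}"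

definition PSD :: "'a::topological_space set \<Rightarrow> ('a \<times> 'a \<Rightarrow> real) set" where
  "PSD V = {K \<in> kernels V. \<forall>U. finite U \<and> U \<subseteq> V \<longrightarrow> psd_matrix U (restrict K (U \<times> U))}"

definition COP :: "'a::topological_space set \<Rightarrow> ('a \<times> 'a \<Rightarrow> real) set" where
  "COP V = {K \<in> kernels V. \<forall>U. finite U \<and> U \<subseteq> V \<longrightarrow> copositive_matrix U (restrict K (U \<times> U))}"

text \<open>
  \<^const>\<open>cfunspace\<close> is the space of bounded continuous (extensional) functions with the supremum
  metric; for compact \<open>V\<close> it contains all kernels on \<open>V\<close>.
\<close>

definition kernel_topology :: "'a::topological_space set \<Rightarrow> ('a \<times> 'a \<Rightarrow> real) topology" where
  "kernel_topology V =
     subtopology (mtopology_of (cfunspace (top_of_set (V \<times> V)) euclidean_metric)) (kernels V)"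

text \<open>\<open>V\<^sup>d\<close>, with the coordinates of a tuple numbered from \<open>0\<close> to \<open>d - 1\<close>.\<close>

definition tuples :: "'a set \<Rightarrow> nat \<Rightarrow> (nat \<Rightarrow> 'a) set" where
  "tuples V d = {..<d} \<rightarrow>\<^sub>E V"

definition tensors :: "'a set \<Rightarrow> nat \<Rightarrow> ((nat \<Rightarrow> 'a) \<Rightarrow> real) set" where
  "tensors V d = extensional (tuples V d)"

definition nonneg_tensors :: "'a set \<Rightarrow> nat \<Rightarrow> ((nat \<Rightarrow> 'a) \<Rightarrow> real) set" where
  "nonneg_tensors V d = {T \<in> tensors V d. \<forall>v\<in>tuples V d. T v \<ge> 0}"

definition tensor_add ::
    "'a set \<Rightarrow> nat \<Rightarrow> ((nat \<Rightarrow> 'a) \<Rightarrow> real) \<Rightarrow> ((nat \<Rightarrow> 'a) \<Rightarrow> real) \<Rightarrow> (nat \<Rightarrow> 'a) \<Rightarrow> real" where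
  "tensor_add V d S T = (\<lambda>v\<in>tuples V d. S v + T v)"

definition kernel_tensor :: "'a set \<Rightarrow> ('a \<times> 'a \<Rightarrow> real) \<Rightarrow> (nat \<Rightarrow> 'a) \<Rightarrow> real" where
  "kernel_tensor V K = (\<lambda>v\<in>tuples V 2. K (v 0, v 1))"

text \<open>\<open>stack V d r\<close> maps tensors of order \<open>d\<close> to tensors of order \<open>d + r\<close>.\<close>

definition stack ::
    "'a set \<Rightarrow> nat \<Rightarrow> nat \<Rightarrow> ((nat \<Rightarrow> 'a) \<Rightarrow> real) \<Rightarrow> (nat \<Rightarrow> 'a) \<Rightarrow> real" where
  "stack V d r T = (\<lambda>w\<in>tuples V (d + r). T (restrict w {..<d}))"

text \<open>As \<open>\<pi>\<close> fixes everything outside \<open>{..<d}\<close>, the tuple \<open>v \<circ> \<pi>\<close> is again in \<open>tuples V d\<close>.\<close>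

definition symmetrize :: "'a set \<Rightarrow> nat \<Rightarrow> ((nat \<Rightarrow> 'a) \<Rightarrow> real) \<Rightarrow> (nat \<Rightarrow> 'a) \<Rightarrow> real" where
  "symmetrize V d T = (\<lambda>v\<in>tuples V d. (\<Sum>\<pi> | \<pi> permutes {..<d}. T (v \<circ> \<pi>)) / fact d)"

text \<open>\<open>case_nat x (case_nat y z)\<close> is the tuple \<open>(x, y, z\<^sub>0, \<dots>, z\<^sub>r\<^sub>-\<^sub>1)\<close>.\<close>

definition two_PSD :: "'a::topological_space set \<Rightarrow> nat \<Rightarrow> ((nat \<Rightarrow> 'a) \<Rightarrow> real) set" where
  "two_PSD V r = {F \<in> tensors V (r + 2).
     continuous_map (product_topology (\<lambda>_. top_of_set V) {..<r + 2}) euclideanreal F \<and>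
     (\<forall>z\<in>tuples V r. (\<lambda>(x, y)\<in>V \<times> V. F (case_nat x (case_nat y z))) \<in> PSD V)}"

definition C_cone :: "'a::topological_space set \<Rightarrow> nat \<Rightarrow> ('a \<times> 'a \<Rightarrow> real) set" where
  "C_cone V r = {M \<in> kernels V. \<exists>N \<in> nonneg_tensors V (r + 2).
     symmetrize V (r + 2) (stack V 2 r (kernel_tensor V M)) = symmetrize V (r + 2) N}"

definition Q_cone :: "'a::topological_space set \<Rightarrow> nat \<Rightarrow> ('a \<times> 'a \<Rightarrow> real) set" where
  "Q_cone V r = {M \<in> kernels V. \<exists>N \<in> nonneg_tensors V (r + 2). \<exists>S \<in> two_PSD V r.
     symmetrize V (r + 2) (stack V 2 r (kernel_tensor V M)) =
       tensor_add V (r + 2) (symmetrize V (r + 2) N) (symmetrize V (r + 2) S)}"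

end

theory Submission
  imports Defs
begin

text \<open>
  For the chains of inclusions, \<open>\<sigma>(Stk(\<sigma>(T))) = \<sigma>(Stk(T))\<close>, so a decomposition of order \<open>r\<close> can be
  stacked to one of order \<open>r + 1\<close>.  For copositivity, \<open>\<Sum>\<^sub>v T(v) \<Prod>\<^sub>i x(v\<^sub>i)\<close>, with \<open>v\<close> ranging over
  the tuples from a finite \<open>U\<close>, does not change under symmetrization; for \<open>T = Stk\<^sup>r(M)\<close> it is
  \<open>x\<^sup>TMx\<close> times \<open>(\<Sum>x)\<^sup>r\<close>, and for nonnegative or 2-PSD \<open>T\<close> it is nonnegative.  Finally, if \<open>M - \<epsilon>\<close>
  is copositive and \<open>M \<le> B\<close>, then with \<open>d = r + 2\<close> the symmetrization of \<open>Stk\<^sup>r(M)\<close> at \<open>v\<close> is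
  \<open>1/(d(d-1))\<close> times \<open>\<Sum>\<^sub>i\<^sub>j M(v\<^sub>i, v\<^sub>j) - \<Sum>\<^sub>i M(v\<^sub>i, v\<^sub>i) \<ge> \<epsilon> d\<^sup>2 - B d\<close>, which is nonnegative for large \<open>r\<close>.
\<close>

subsection \<open>Tuples and permutations\<close>

lemma tuples_comp_permutes:
  assumes "v \<in> tuples V d" "\<pi> permutes {..<d}"
  shows "v \<circ> \<pi> \<in> tuples V d"
  using assms permutes_in_image[OF assms(2)]
  by (auto simp: tuples_def PiE_iff extensional_def permutes_not_in)

lemma restrict_tuples: "w \<in> tuples V (d + s) \<Longrightarrow> restrict w {..<d} \<in> tuples V d"
  by (simp add: tuples_def PiE_iff)

lemma case_nat_tuples: "x \<in> V \<Longrightarrow> z \<in> tuples V d \<Longrightarrow> case_nat x z \<in> tuples V (Suc d)"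
  by (auto simp: tuples_def PiE_iff extensional_def split: nat.splits)

lemma tuples_mono: "U \<subseteq> V \<Longrightarrow> tuples U d \<subseteq> tuples V d"
  unfolding tuples_def by (rule PiE_mono)

lemma bij_betw_comp_tuples:
  assumes "\<pi> permutes {..<d}"
  shows "bij_betw (\<lambda>v. v \<circ> \<pi>) (tuples V d) (tuples V d)"
  by (rule bij_betw_byWitness[where f' = "\<lambda>v. v \<circ> inv \<pi>"])
    (auto intro: tuples_comp_permutes permutes_inv assms
      simp: comp_assoc permutes_inv_o[OF assms])

lemma bij_betw_case_nat_tuples:
  "bij_betw (\<lambda>(x, z). case_nat x z) (V \<times> tuples V d) (tuples V (Suc d))"
proof (rule bij_betw_byWitness[where f' = "\<lambda>v. (v 0, v \<circ> Suc)"])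
  show "\<forall>v\<in>tuples V (Suc d). (case (v 0, v \<circ> Suc) of (x, z) \<Rightarrow> case_nat x z) = v"
    by (auto simp: fun_eq_iff split: nat.splits)
qed (auto intro: case_nat_tuples, auto simp: fun_eq_iff tuples_def PiE_iff extensional_def)

lemma permutes_onto_pair:
  fixes i j :: nat
  assumes "i < d" "j < d" "i \<noteq> j"
  obtains \<rho> where "\<rho> permutes {..<d}" "\<rho> 0 = i" "\<rho> 1 = j"
proof
  \<comment> \<open>\<open>?k\<close> is the preimage of \<open>j\<close> under the swap of
    \<open>0\<close> and \<open>i\<close>. As \<open>i \<noteq> j\<close>, it is nonzero, so
    swapping \<open>1\<close> with \<open>?k\<close> fixes \<open>0\<close>, and the outer swap then
    sends \<open>0\<close> to \<open>i\<close> and \<open>?k\<close> to \<open>j\<close>.\<close>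
  let ?k = "Transposition.transpose 0 i j"
  have d: "1 < d" using assms by auto
  have k: "?k < d" "?k \<noteq> 0" using assms by (auto simp: Transposition.transpose_def)
  show "Transposition.transpose 0 i \<circ> Transposition.transpose 1 ?k permutes {..<d}"
    using assms k d by (intro permutes_compose permutes_swap_id) auto
  show "(Transposition.transpose 0 i \<circ> Transposition.transpose 1 ?k) 0 = i" using k by (simp add: Transposition.transpose_def)
  show "(Transposition.transpose 0 i \<circ> Transposition.transpose 1 ?k) 1 = j" by simp
qed

text \<open>Double counting: the permutation sum does not change when the positions \<open>0\<close>
  and \<open>1\<close> are replaced by distinct \<open>i\<close> and \<open>j\<close>, so it can be
  added up over all such pairs and the order of summation exchanged. As a product rather than a
  quotient, the identity also covers \<open>d < 2\<close>, where there are no pairs.\<close>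

lemma sum_permutes_pair:
  fixes a :: "nat \<Rightarrow> nat \<Rightarrow> real"
  shows "real (card {p \<in> {..<d} \<times> {..<d}. fst p \<noteq> snd p}) * (\<Sum>\<pi> | \<pi> permutes {..<d}. a (\<pi> 0) (\<pi> 1))
    = fact d * (\<Sum>(i, j) \<in> {p \<in> {..<d} \<times> {..<d}. fst p \<noteq> snd p}. a i j)"
proof -
  let ?P = "{p \<in> {..<d} \<times> {..<d}. fst p \<noteq> snd p}"
  have "(\<Sum>\<pi> | \<pi> permutes {..<d}. a (\<pi> 0) (\<pi> 1)) = (\<Sum>\<pi> | \<pi> permutes {..<d}. a (\<pi> i) (\<pi> j))"
    if "(i, j) \<in> ?P" for i j
  proof -
    have "i < d" "j < d" "i \<noteq> j" using that by auto
    then obtain \<rho> where \<rho>: "\<rho> permutes {..<d}" "\<rho> 0 = i" "\<rho> 1 = j"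
      by (rule permutes_onto_pair)
    show ?thesis using sum_permutations_compose_right[OF \<rho>(1), of "\<lambda>\<pi>. a (\<pi> 0) (\<pi> 1)"] \<rho> by simp
  qed
  then have "real (card ?P) * (\<Sum>\<pi> | \<pi> permutes {..<d}. a (\<pi> 0) (\<pi> 1))
    = (\<Sum>(i, j) \<in> ?P. \<Sum>\<pi> | \<pi> permutes {..<d}. a (\<pi> i) (\<pi> j))"
    by (subst sum_constant[symmetric]) (intro sum.cong, auto)
  also have "\<dots> = (\<Sum>\<pi> | \<pi> permutes {..<d}. \<Sum>(i, j) \<in> ?P. a (\<pi> i) (\<pi> j))"
    by (subst sum.swap) (simp add: case_prod_unfold)
  \<comment> \<open>A permutation acts bijectively on the pairs of distinct positions, so the inner
    sum does not depend on it.\<close>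
  also have "\<dots> = (\<Sum>\<pi> | \<pi> permutes {..<d}. \<Sum>(i, j) \<in> ?P. a i j)"
  proof (rule sum.cong[OF refl])
    fix \<pi> :: "nat \<Rightarrow> nat"
    assume "\<pi> \<in> {\<pi>. \<pi> permutes {..<d}}"
    then have \<pi>: "\<pi> permutes {..<d}" by simp
    have "bij_betw (map_prod \<pi> \<pi>) ?P ?P"
      by (rule bij_betw_byWitness[where f' = "map_prod (inv \<pi>) (inv \<pi>)"])
        (use permutes_in_image[OF \<pi>] permutes_in_image[OF permutes_inv[OF \<pi>]]
           permutes_inverses[OF \<pi>] in \<open>auto, metis+\<close>)
    from sum.reindex_bij_betw[OF this, of "\<lambda>(i, j). a i j"]
    show "(\<Sum>(i, j) \<in> ?P. a (\<pi> i) (\<pi> j)) = (\<Sum>(i, j) \<in> ?P. a i j)"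
      by (simp add: case_prod_unfold)
  qed
  also have "\<dots> = fact d * (\<Sum>(i, j) \<in> ?P. a i j)"
    by (simp add: card_permutations[of "{..<d}" d])
  finally show ?thesis .
qed

subsection \<open>Symmetrization and stacking\<close>

text \<open>A permutation \<open>\<tau>\<close> of the first \<open>d\<close> positions also
  permutes all \<open>d + s\<close> positions, so the outer average absorbs it by right composition.
  What remains of the inner average is a mean of \<open>fact d\<close> equal terms.\<close>

lemma symmetrize_stack_symmetrize:
  "symmetrize V (d + s) (stack V d s (symmetrize V d T)) = symmetrize V (d + s) (stack V d s T)"
proof (rule ext)
  fix v
  show "symmetrize V (d + s) (stack V d s (symmetrize V d T)) v = symmetrize V (d + s) (stack V d s T) v"
  proof (cases "v \<in> tuples V (d + s)")
    case v: True
    have step: "stack V d s (symmetrize V d T) (v \<circ> \<pi>)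
        = (\<Sum>\<tau> | \<tau> permutes {..<d}. stack V d s T (v \<circ> (\<pi> \<circ> \<tau>))) / fact d"
      if \<pi>: "\<pi> permutes {..<d + s}" for \<pi>
    proof -
      have "stack V d s T (v \<circ> (\<pi> \<circ> \<tau>)) = T (restrict (v \<circ> \<pi>) {..<d} \<circ> \<tau>)"
        if \<tau>: "\<tau> permutes {..<d}" for \<tau>
      proof -
        have "\<tau> permutes {..<d + s}" using \<tau> by (rule permutes_subset) auto
        then have "v \<circ> (\<pi> \<circ> \<tau>) \<in> tuples V (d + s)"
          using \<pi> v by (intro tuples_comp_permutes permutes_compose)
        \<comment> \<open>\<open>\<tau>\<close> maps the first \<open>d\<close> positions to
          themselves, so it commutes with cutting off the tail.\<close>
        moreover have "restrict (v \<circ> (\<pi> \<circ> \<tau>)) {..<d} = restrict (v \<circ> \<pi>) {..<d} \<circ> \<tau>"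
          using permutes_in_image[OF \<tau>] by (auto simp: fun_eq_iff restrict_def)
        ultimately show ?thesis by (simp add: stack_def)
      qed
      then show ?thesis
        using tuples_comp_permutes[OF v \<pi>] restrict_tuples[OF tuples_comp_permutes[OF v \<pi>]]
        by (simp add: stack_def symmetrize_def)
    qed
    have "(\<Sum>\<pi> | \<pi> permutes {..<d + s}. stack V d s (symmetrize V d T) (v \<circ> \<pi>))
      = (\<Sum>\<pi> | \<pi> permutes {..<d + s}. (\<Sum>\<tau> | \<tau> permutes {..<d}. stack V d s T (v \<circ> (\<pi> \<circ> \<tau>))) / fact d)"
      by (intro sum.cong refl step) simp
    also have "\<dots> = (\<Sum>\<tau> | \<tau> permutes {..<d}.
        \<Sum>\<pi> | \<pi> permutes {..<d + s}. stack V d s T (v \<circ> (\<pi> \<circ> \<tau>))) / fact d"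
      by (subst sum.swap) (simp add: sum_divide_distrib)
    also have "\<dots> = (\<Sum>\<tau> | \<tau> permutes {..<d}.
        \<Sum>\<pi> | \<pi> permutes {..<d + s}. stack V d s T (v \<circ> \<pi>)) / fact d"
    proof (rule arg_cong[where f = "\<lambda>t. t / fact d"], rule sum.cong[OF refl])
      fix \<tau> :: "nat \<Rightarrow> nat"
      assume "\<tau> \<in> {\<tau>. \<tau> permutes {..<d}}"
      then have "\<tau> permutes {..<d + s}" by (auto intro: permutes_subset)
      from sum_permutations_compose_right[OF this, of "\<lambda>\<pi>. stack V d s T (v \<circ> \<pi>)"]
      show "(\<Sum>\<pi> | \<pi> permutes {..<d + s}. stack V d s T (v \<circ> (\<pi> \<circ> \<tau>)))
        = (\<Sum>\<pi> | \<pi> permutes {..<d + s}. stack V d s T (v \<circ> \<pi>))" by simp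
    qed
    also have "\<dots> = (\<Sum>\<pi> | \<pi> permutes {..<d + s}. stack V d s T (v \<circ> \<pi>))"
      by (simp add: card_permutations[of "{..<d}" d])
    finally show ?thesis using v by (simp add: symmetrize_def)
  qed (simp add: symmetrize_def)
qed

text \<open>The case \<open>s = 0\<close> of the previous lemma: stacking by zero can change a
  function only outside the tuples, where symmetrization does not look.\<close>

lemma symmetrize_symmetrize: "symmetrize V d (symmetrize V d T) = symmetrize V d T"
proof -
  have "symmetrize V d (stack V d 0 F) = symmetrize V d F" for F :: "(nat \<Rightarrow> 'a) \<Rightarrow> real"
  proof -
    have "stack V d 0 F w = F w" if "w \<in> tuples V d" for w
      using that by (simp add: stack_def tuples_def PiE_restrict)
    then show ?thesis by (auto simp: symmetrize_def fun_eq_iff tuples_comp_permutes)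
  qed
  then show ?thesis using symmetrize_stack_symmetrize[of V d 0 T] by simp
qed

lemma symmetrize_tensor_add:
  "symmetrize V d (tensor_add V d S T) = tensor_add V d (symmetrize V d S) (symmetrize V d T)"
proof (rule ext)
  fix v
  show "symmetrize V d (tensor_add V d S T) v
    = tensor_add V d (symmetrize V d S) (symmetrize V d T) v"
  proof (cases "v \<in> tuples V d")
    case True
    then have "(\<Sum>\<pi> | \<pi> permutes {..<d}. tensor_add V d S T (v \<circ> \<pi>))
      = (\<Sum>\<pi> | \<pi> permutes {..<d}. S (v \<circ> \<pi>) + T (v \<circ> \<pi>))"
      by (intro sum.cong refl) (simp add: tensor_add_def tuples_comp_permutes)
    with True show ?thesis
      by (simp add: symmetrize_def tensor_add_def sum.distrib add_divide_distrib)
  qed (simp add: symmetrize_def tensor_add_def)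
qed

lemma stack_tensor_add:
  "stack V d s (tensor_add V d S T) = tensor_add V (d + s) (stack V d s S) (stack V d s T)"
  by (auto simp: stack_def tensor_add_def fun_eq_iff restrict_tuples)

lemma stack_stack: "stack V (d + r) s (stack V d r T) = stack V d (r + s) T"
proof -
  have "{..<d + r} \<inter> {..<d} = {..<d}" by auto
  moreover have "restrict w {..<d + r} \<in> tuples V (d + r)" if "w \<in> tuples V (d + (r + s))" for w
    using that by (intro restrict_tuples[where s = s]) (simp add: add.assoc)
  ultimately show ?thesis
    by (auto simp: stack_def fun_eq_iff add.assoc)
qed

text \<open>Brings the left-hand side of the defining equation at level \<open>r\<close> into the
  one at level \<open>Suc r\<close>, so that a decomposition can be substituted.\<close>

lemma symmetrize_stack_Suc:
  "symmetrize V (Suc r + 2) (stack V 2 (Suc r) T)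
    = symmetrize V (Suc r + 2) (stack V (r + 2) 1 (symmetrize V (r + 2) (stack V 2 r T)))"
  using symmetrize_stack_symmetrize[of V "r + 2" 1 "stack V 2 r T"] stack_stack[of V 2 r 1 T]
  by (simp add: add.commute)

section \<open>Stacked decompositions and the chains of inclusions\<close>

lemma stack_nonneg_tensors:
  "N \<in> nonneg_tensors V d \<Longrightarrow> stack V d s N \<in> nonneg_tensors V (d + s)"
  by (auto simp: nonneg_tensors_def tensors_def stack_def restrict_tuples)

text \<open>The new coordinates are appended at the end, so the slice at \<open>z\<close> is the
  slice of \<open>S\<close> at the first \<open>r\<close> entries of \<open>z\<close>. Continuity
  holds because stacking is composition with a projection.\<close>

lemma stack_two_PSD:
  assumes S: "S \<in> two_PSD V r"
  shows "stack V (r + 2) s S \<in> two_PSD V (r + s)"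
proof -
  have eq: "r + s + 2 = r + 2 + s" by simp
  let ?P = "\<lambda>d. product_topology (\<lambda>_. top_of_set V) {..<d :: nat}"
  have top: "topspace (?P d) = tuples V d" for d by (simp add: tuples_def)
  have "continuous_map (?P (r + 2 + s)) (?P (r + 2)) (\<lambda>w. restrict w {..<r + 2})"
    by (rule continuous_on_restrict) simp
  from continuous_map_compose[OF this, of euclideanreal S] S
  have "continuous_map (?P (r + 2 + s)) euclideanreal (S \<circ> (\<lambda>w. restrict w {..<r + 2}))"
    by (simp add: two_PSD_def)
  then have cont: "continuous_map (?P (r + 2 + s)) euclideanreal (stack V (r + 2) s S)"
    by (rule continuous_map_eq) (simp only: top, simp add: stack_def)
  have "(\<lambda>(x, y)\<in>V \<times> V. stack V (r + 2) s S (case_nat x (case_nat y z))) \<in> PSD V"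
    if z: "z \<in> tuples V (r + s)" for z
  proof -
    have "stack V (r + 2) s S (case_nat x (case_nat y z)) = S (case_nat x (case_nat y (restrict z {..<r})))"
      if "x \<in> V" "y \<in> V" for x y
    proof -
      have "restrict (case_nat x (case_nat y z)) {..<r + 2} = case_nat x (case_nat y (restrict z {..<r}))"
        by (auto simp: fun_eq_iff split: nat.splits)
      moreover have "case_nat x (case_nat y z) \<in> tuples V (r + 2 + s)"
        using case_nat_tuples[OF that(1) case_nat_tuples[OF that(2) z]] by simp
      ultimately show ?thesis by (simp add: stack_def)
    qed
    then have "(\<lambda>(x, y)\<in>V \<times> V. stack V (r + 2) s S (case_nat x (case_nat y z)))
      = (\<lambda>(x, y)\<in>V \<times> V. S (case_nat x (case_nat y (restrict z {..<r}))))"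
      by (auto simp: fun_eq_iff)
    then show ?thesis using S restrict_tuples[OF z] by (simp add: two_PSD_def)
  qed
  with cont show ?thesis
    unfolding two_PSD_def eq by (auto simp: tensors_def stack_def)
qed

lemma C_cone_Suc: "C_cone V r \<subseteq> C_cone V (Suc r)"
proof
  fix M assume "M \<in> C_cone V r"
  then obtain N where M: "M \<in> kernels V" and N: "N \<in> nonneg_tensors V (r + 2)"
    and eq: "symmetrize V (r + 2) (stack V 2 r (kernel_tensor V M)) = symmetrize V (r + 2) N"
    by (auto simp: C_cone_def)
  have "symmetrize V (Suc r + 2) (stack V 2 (Suc r) (kernel_tensor V M))
    = symmetrize V (Suc r + 2) (stack V (r + 2) 1 N)"
    unfolding symmetrize_stack_Suc eq
    using symmetrize_stack_symmetrize[of V "r + 2" 1 N] by simp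
  moreover have "stack V (r + 2) 1 N \<in> nonneg_tensors V (Suc r + 2)"
    using stack_nonneg_tensors[OF N, of 1] by simp
  ultimately show "M \<in> C_cone V (Suc r)" using M unfolding C_cone_def by blast
qed

lemma Q_cone_Suc: "Q_cone V r \<subseteq> Q_cone V (Suc r)"
proof
  fix M assume "M \<in> Q_cone V r"
  then obtain N S where M: "M \<in> kernels V" and N: "N \<in> nonneg_tensors V (r + 2)"
    and S: "S \<in> two_PSD V r"
    and eq: "symmetrize V (r + 2) (stack V 2 r (kernel_tensor V M))
      = tensor_add V (r + 2) (symmetrize V (r + 2) N) (symmetrize V (r + 2) S)"
    by (auto simp: Q_cone_def)
  have "symmetrize V (Suc r + 2) (stack V 2 (Suc r) (kernel_tensor V M))
    = tensor_add V (Suc r + 2) (symmetrize V (Suc r + 2) (stack V (r + 2) 1 N))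
        (symmetrize V (Suc r + 2) (stack V (r + 2) 1 S))"
    unfolding symmetrize_stack_Suc eq stack_tensor_add
    using symmetrize_stack_symmetrize[of V "r + 2" 1] symmetrize_tensor_add[of V "Suc r + 2"] by simp
  moreover have "stack V (r + 2) 1 N \<in> nonneg_tensors V (Suc r + 2)"
    using stack_nonneg_tensors[OF N, of 1] by simp
  moreover have "stack V (r + 2) 1 S \<in> two_PSD V (Suc r)"
    using stack_two_PSD[OF S, of 1] by simp
  ultimately show "M \<in> Q_cone V (Suc r)" using M unfolding Q_cone_def by blast
qed

text \<open>Supplies the 2-PSD summand when a decomposition for \<open>C_cone\<close> is read as one
  for \<open>Q_cone\<close>.\<close>

lemma zero_two_PSD: "(\<lambda>v\<in>tuples V (r + 2). 0) \<in> two_PSD V r"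
proof -
  have "(\<lambda>(x, y)\<in>V \<times> V. (\<lambda>v\<in>tuples V (r + 2). 0::real) (case_nat x (case_nat y z))) = (\<lambda>p\<in>V \<times> V. 0)"
    if "z \<in> tuples V r" for z
    using case_nat_tuples[OF _ case_nat_tuples[OF _ that]] by (auto simp: fun_eq_iff)
  moreover have "(\<lambda>p\<in>V \<times> V. 0) \<in> kernels V" by (simp add: kernels_def)
  then have "(\<lambda>p\<in>V \<times> V. 0) \<in> PSD V"
    by (auto simp: PSD_def psd_matrix_def symmetric_matrix_def quadratic_form_def subset_iff
        intro!: sum_nonneg)
  moreover have "continuous_map (product_topology (\<lambda>_. top_of_set V) {..<r + 2}) euclideanreal
      (\<lambda>v\<in>tuples V (r + 2). 0)"
    by (rule continuous_map_eq[where f = "\<lambda>_. 0"]) (auto simp: tuples_def)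
  ultimately show ?thesis by (simp add: two_PSD_def tensors_def)
qed

lemma C_cone_subset_Q_cone: "C_cone V r \<subseteq> Q_cone V r"
proof
  fix M assume "M \<in> C_cone V r"
  then obtain N where M: "M \<in> kernels V" and N: "N \<in> nonneg_tensors V (r + 2)"
    and eq: "symmetrize V (r + 2) (stack V 2 r (kernel_tensor V M)) = symmetrize V (r + 2) N"
    by (auto simp: C_cone_def)
  have "symmetrize V (r + 2) N = tensor_add V (r + 2) (symmetrize V (r + 2) N)
      (symmetrize V (r + 2) (\<lambda>v\<in>tuples V (r + 2). 0))"
    by (auto simp: tensor_add_def symmetrize_def fun_eq_iff tuples_comp_permutes)
  with M N eq show "M \<in> Q_cone V r" using zero_two_PSD[of V r] unfolding Q_cone_def by fastforce
qed

subsection \<open>Copositivity of the kernels in the cones\<close>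

lemma quadratic_form_restrict:
  "quadratic_form U (restrict K (U \<times> U)) x = (\<Sum>i\<in>U. \<Sum>j\<in>U. x i * K (i, j) * x j)"
  by (simp add: quadratic_form_def)

lemma COP_iff:
  "K \<in> COP V \<longleftrightarrow> K \<in> kernels V \<and> (\<forall>U x. finite U \<longrightarrow> U \<subseteq> V \<longrightarrow> (\<forall>i\<in>U. x i \<ge> 0) \<longrightarrow>
     (\<Sum>i\<in>U. \<Sum>j\<in>U. x i * K (i, j) * x j) \<ge> 0)"
  by (auto simp: COP_def copositive_matrix_def quadratic_form_restrict symmetric_matrix_def
      kernels_def subset_iff)

text \<open>The multilinear form with coefficients \<open>T\<close>, evaluated at \<open>d\<close>
  copies of the weight vector \<open>x\<close>.\<close>

definition tensor_form :: "'a set \<Rightarrow> nat \<Rightarrow> ((nat \<Rightarrow> 'a) \<Rightarrow> real) \<Rightarrow> ('a \<Rightarrow> real) \<Rightarrow> real" where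
  "tensor_form U d T x = (\<Sum>v\<in>tuples U d. T v * (\<Prod>i<d. x (v i)))"

text \<open>The product of the weights is invariant under permuting the tuple, and composition with
  \<open>\<pi>\<close> is a bijection of the tuples from \<open>U\<close>; hence every permutation
  contributes the same form.\<close>

lemma tensor_form_symmetrize:
  assumes "U \<subseteq> V"
  shows "tensor_form U d (symmetrize V d T) x = tensor_form U d T x"
proof -
  have "tensor_form U d (symmetrize V d T) x
    = (\<Sum>v\<in>tuples U d. (\<Sum>\<pi> | \<pi> permutes {..<d}. T (v \<circ> \<pi>) * (\<Prod>i<d. x ((v \<circ> \<pi>) i))) / fact d)"
    unfolding tensor_form_def
  proof (rule sum.cong[OF refl])
    fix v assume "v \<in> tuples U d"
    then have "v \<in> tuples V d" using tuples_mono[OF assms] by blast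
    moreover have "(\<Prod>i<d. x ((v \<circ> \<pi>) i)) = (\<Prod>i<d. x (v i))" if "\<pi> permutes {..<d}" for \<pi>
      using prod.permute[OF that, of "\<lambda>i. x (v i)"] by (simp add: o_def)
    ultimately show "symmetrize V d T v * (\<Prod>i<d. x (v i))
      = (\<Sum>\<pi> | \<pi> permutes {..<d}. T (v \<circ> \<pi>) * (\<Prod>i<d. x ((v \<circ> \<pi>) i))) / fact d"
      by (simp add: symmetrize_def sum_distrib_right del: o_apply)
  qed
  also have "\<dots> = (\<Sum>\<pi> | \<pi> permutes {..<d}. \<Sum>v\<in>tuples U d. T (v \<circ> \<pi>) * (\<Prod>i<d. x ((v \<circ> \<pi>) i))) / fact d"
    by (subst sum.swap) (simp add: sum_divide_distrib)
  also have "\<dots> = (\<Sum>\<pi> | \<pi> permutes {..<d}. tensor_form U d T x) / fact d"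
    unfolding tensor_form_def
    by (intro arg_cong2[of _ _ _ _ "(/)"] sum.cong refl
        sum.reindex_bij_betw[OF bij_betw_comp_tuples, of _ _ "\<lambda>v. T v * (\<Prod>i<d. x (v i))"]) simp
  also have "\<dots> = tensor_form U d T x"
    by (simp add: card_permutations[of "{..<d}" d])
  finally show ?thesis .
qed

lemma tensor_form_tensor_add:
  "U \<subseteq> V \<Longrightarrow> tensor_form U d (tensor_add V d S T) x = tensor_form U d S x + tensor_form U d T x"
  using tuples_mono[of U V d]
  by (auto simp: tensor_form_def tensor_add_def sum.distrib[symmetric] algebra_simps intro!: sum.cong)

lemma tensor_form_nonneg:
  assumes "\<And>v. v \<in> tuples U d \<Longrightarrow> 0 \<le> T v" "\<And>i. i \<in> U \<Longrightarrow> 0 \<le> x i"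
  shows "0 \<le> tensor_form U d T x"
  unfolding tensor_form_def
  using assms by (intro sum_nonneg mult_nonneg_nonneg prod_nonneg) (auto simp: tuples_def)

lemma tensor_form_Suc:
  "tensor_form U (Suc d) T x = (\<Sum>a\<in>U. x a * tensor_form U d (\<lambda>z. T (case_nat a z)) x)"
proof -
  have "tensor_form U (Suc d) T x
    = (\<Sum>(a, z)\<in>U \<times> tuples U d. T (case_nat a z) * (x a * (\<Prod>i<d. x (z i))))"
    unfolding tensor_form_def
    by (subst sum.reindex_bij_betw[OF bij_betw_case_nat_tuples, symmetric])
      (simp add: case_prod_unfold prod.lessThan_Suc_shift del: prod.lessThan_Suc)
  also have "\<dots> = (\<Sum>a\<in>U. x a * tensor_form U d (\<lambda>z. T (case_nat a z)) x)"
    by (simp add: sum.cartesian_product[symmetric] tensor_form_def sum_distrib_left mult_ac)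
  finally show ?thesis .
qed

lemma tensor_form_const: "tensor_form U d (\<lambda>_. c) x = c * (\<Sum>a\<in>U. x a) ^ d"
proof (induction d)
  case 0
  show ?case by (simp add: tensor_form_def tuples_def)
next
  case (Suc d)
  then show ?case by (simp add: tensor_form_Suc sum_distrib_right[symmetric])
qed

text \<open>The inner double sum is the quadratic form of the slice of \<open>T\<close> at
  \<open>z\<close>. This suits 2-PSD tensors, whose slices are PSD, and stacked kernels, whose
  slices do not depend on \<open>z\<close>.\<close>

lemma tensor_form_two:
  "tensor_form U (r + 2) T x = (\<Sum>z\<in>tuples U r.
    (\<Sum>a\<in>U. \<Sum>b\<in>U. x a * T (case_nat a (case_nat b z)) * x b) * (\<Prod>i<r. x (z i)))"
proof -
  have "tensor_form U (r + 2) T x = (\<Sum>a\<in>U. \<Sum>b\<in>U. \<Sum>z\<in>tuples U r.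
      x a * T (case_nat a (case_nat b z)) * x b * (\<Prod>i<r. x (z i)))"
    by (simp add: tensor_form_Suc) (simp add: tensor_form_def sum_distrib_left mult_ac)
  also have "\<dots> = (\<Sum>a\<in>U. \<Sum>z\<in>tuples U r. \<Sum>b\<in>U.
      x a * T (case_nat a (case_nat b z)) * x b * (\<Prod>i<r. x (z i)))"
    by (intro sum.cong refl sum.swap)
  also have "\<dots> = (\<Sum>z\<in>tuples U r. \<Sum>a\<in>U. \<Sum>b\<in>U.
      x a * T (case_nat a (case_nat b z)) * x b * (\<Prod>i<r. x (z i)))"
    by (rule sum.swap)
  finally show ?thesis by (simp add: sum_distrib_right)
qed

lemma stack_kernel_tensor:
  assumes "v \<in> tuples V (r + 2)"
  shows "stack V 2 r (kernel_tensor V M) v = M (v 0, v 1)"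
proof -
  have "v \<in> tuples V (2 + r)" using assms by (simp add: add.commute)
  then show ?thesis using restrict_tuples[of v V 2 r] by (simp add: stack_def kernel_tensor_def)
qed

lemma tensor_form_stack_kernel:
  assumes "U \<subseteq> V"
  shows "tensor_form U (r + 2) (stack V 2 r (kernel_tensor V M)) x
    = (\<Sum>a\<in>U. \<Sum>b\<in>U. x a * M (a, b) * x b) * (\<Sum>a\<in>U. x a) ^ r"
proof -
  have "tensor_form U (r + 2) (stack V 2 r (kernel_tensor V M)) x = tensor_form U (r + 2) (\<lambda>v. M (v 0, v 1)) x"
    unfolding tensor_form_def
  proof (rule sum.cong[OF refl])
    fix v assume "v \<in> tuples U (r + 2)"
    then show "stack V 2 r (kernel_tensor V M) v * (\<Prod>i<r + 2. x (v i)) = M (v 0, v 1) * (\<Prod>i<r + 2. x (v i))"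
      using stack_kernel_tensor[of v V r M] tuples_mono[OF assms, of "r + 2"] by auto
  qed
  also have "\<dots> = (\<Sum>a\<in>U. \<Sum>b\<in>U. x a * M (a, b) * x b) * tensor_form U r (\<lambda>_. 1) x"
    unfolding tensor_form_two by (simp add: tensor_form_def sum_distrib_left)
  finally show ?thesis by (simp add: tensor_form_const)
qed

lemma tensor_form_two_PSD:
  assumes "finite U" "U \<subseteq> V" "S \<in> two_PSD V r" "\<And>i. i \<in> U \<Longrightarrow> 0 \<le> x i"
  shows "0 \<le> tensor_form U (r + 2) S x"
  unfolding tensor_form_two
proof (rule sum_nonneg, rule mult_nonneg_nonneg)
  fix z assume z: "z \<in> tuples U r"
  then show "0 \<le> (\<Prod>i<r. x (z i))"
    using assms(4) by (intro prod_nonneg) (auto simp: tuples_def)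
  let ?K = "\<lambda>(a, b)\<in>V \<times> V. S (case_nat a (case_nat b z))"
  have "?K \<in> PSD V"
    using z tuples_mono[OF assms(2)] assms(3) by (auto simp: two_PSD_def)
  then have "0 \<le> quadratic_form U (restrict ?K (U \<times> U)) x"
    using assms(1,2) unfolding PSD_def psd_matrix_def by blast
  also have "\<dots> = (\<Sum>a\<in>U. \<Sum>b\<in>U. x a * S (case_nat a (case_nat b z)) * x b)"
    unfolding quadratic_form_restrict using assms(2) by (intro sum.cong refl) (auto simp: subset_iff)
  finally show "0 \<le> (\<Sum>a\<in>U. \<Sum>b\<in>U. x a * S (case_nat a (case_nat b z)) * x b)" .
qed

lemma Q_cone_subset_COP: "Q_cone V r \<subseteq> COP V"
proof
  fix M assume "M \<in> Q_cone V r"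
  then obtain N S where M: "M \<in> kernels V" and N: "N \<in> nonneg_tensors V (r + 2)"
    and S: "S \<in> two_PSD V r"
    and eq: "symmetrize V (r + 2) (stack V 2 r (kernel_tensor V M))
      = tensor_add V (r + 2) (symmetrize V (r + 2) N) (symmetrize V (r + 2) S)"
    by (auto simp: Q_cone_def)
  have "0 \<le> (\<Sum>a\<in>U. \<Sum>b\<in>U. x a * M (a, b) * x b)"
    if U: "finite U" "U \<subseteq> V" and x: "\<forall>i\<in>U. 0 \<le> x i" for U x
  \<comment> \<open>The form of the stacked kernel carries the factor
    \<open>(\<Sum>a\<in>U. x a) ^ r\<close>, which can be cancelled only if it is positive;
    nonnegative weights with sum zero all vanish.\<close>
  proof (cases "(\<Sum>a\<in>U. x a) = 0")
    case True
    then have "x a = 0" if "a \<in> U" for a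
      using that x U sum_nonneg_eq_0_iff[of U x] by auto
    then show ?thesis by simp
  next
    case False
    then have pos: "(\<Sum>a\<in>U. x a) > 0" using x by (simp add: order_less_le sum_nonneg)
    have "(\<Sum>a\<in>U. \<Sum>b\<in>U. x a * M (a, b) * x b) * (\<Sum>a\<in>U. x a) ^ r
      = tensor_form U (r + 2) (symmetrize V (r + 2) (stack V 2 r (kernel_tensor V M))) x"
      by (simp only: tensor_form_symmetrize[OF U(2)] tensor_form_stack_kernel[OF U(2)])
    also have "\<dots> = tensor_form U (r + 2) N x + tensor_form U (r + 2) S x"
      by (simp only: eq tensor_form_tensor_add[OF U(2)] tensor_form_symmetrize[OF U(2)])
    also have "\<dots> \<ge> 0"
      using N tuples_mono[OF U(2)] x
      by (intro add_nonneg_nonneg tensor_form_nonneg tensor_form_two_PSD[OF U S])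
        (auto simp: nonneg_tensors_def)
    finally show ?thesis using zero_less_power[OF pos, of r] by (simp add: zero_le_mult_iff)
  qed
  with M show "M \<in> COP V" by (simp add: COP_iff)
qed

subsection \<open>The interior of the copositive cone\<close>

text \<open>Entries of a tuple may repeat. Weighting each point by the number of positions at which
  it occurs turns the sum into a quadratic form on the finite set of values, with nonnegative
  weights.\<close>

lemma COP_sum_tuple_nonneg:
  fixes v :: "nat \<Rightarrow> 'a::topological_space"
  assumes K: "K \<in> COP V" and v: "v ` {..<d} \<subseteq> V"
  shows "0 \<le> (\<Sum>i<d. \<Sum>j<d. K (v i, v j))"
proof -
  let ?U = "v ` {..<d}" and ?F = "\<lambda>a. {i \<in> {..<d}. v i = a}"
  let ?x = "\<lambda>a. real (card (?F a))"
  have count: "(\<Sum>i<d. g (v i)) = (\<Sum>a\<in>?U. ?x a * g a)" for g :: "'a \<Rightarrow> real"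
    by (simp add: sum.image_gen[OF finite_lessThan, of "\<lambda>i. g (v i)" d v])
  have "(\<Sum>i<d. \<Sum>j<d. K (v i, v j)) = (\<Sum>a\<in>?U. ?x a * (\<Sum>b\<in>?U. ?x b * K (a, b)))"
    by (simp only: count[of "\<lambda>b. K (_, b)"] count[of "\<lambda>a. \<Sum>b\<in>?U. ?x b * K (a, b)"])
  also have "\<dots> = (\<Sum>a\<in>?U. \<Sum>b\<in>?U. ?x a * K (a, b) * ?x b)"
    by (simp add: sum_distrib_left mult_ac)
  also have "\<dots> \<ge> 0"
    by (rule K[unfolded COP_iff, THEN conjunct2, rule_format, of ?U ?x]) (use v in simp_all)
  finally show ?thesis .
qed

lemma interior_COP_shift:
  assumes V: "compact V" and M: "M \<in> kernel_topology V interior_of COP V"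
  obtains e where "e > 0" "(\<lambda>p\<in>V \<times> V. M p - e) \<in> COP V"
proof -
  let ?m = "cfunspace (top_of_set (V \<times> V)) (euclidean_metric :: real metric)"
  \<comment> \<open>Compactness makes kernels bounded, so that they are points of the function space
    and the supremum distance applies to them.\<close>
  have kernels: "F \<in> mspace ?m" if F: "F \<in> kernels V" for F
  proof -
    have "compact (F ` (V \<times> V))"
      using F V by (intro compact_continuous_image compact_Times) (auto simp: kernels_def)
    then have "bounded (F ` (V \<times> V))" by (rule compact_imp_bounded)
    with F show ?thesis by (simp add: kernels_def)
  qed
  obtain T where T: "openin (mtopology_of ?m) T" "M \<in> T" "T \<inter> kernels V \<subseteq> COP V" and MV: "M \<in> kernels V"
    using M by (auto simp: interior_of_def kernel_topology_def openin_subtopology)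
  obtain e where e: "e > 0" "mball_of ?m M e \<subseteq> T"
    using T(1,2) unfolding mtopology_of_def mball_of_def
    by (metis Metric_space.openin_mtopology Metric_space_mspace_mdist)
  \<comment> \<open>Half the radius, because the distance bound below is not strict while the ball
    is open.\<close>
  let ?K = "\<lambda>p\<in>V \<times> V. M p - e / 2"
  have "continuous_on (V \<times> V) ?K"
    using MV by (auto simp: kernels_def intro!: continuous_intros cong: continuous_on_cong)
  then have K: "?K \<in> kernels V" using MV by (auto simp: kernels_def)
  have "mdist ?m M ?K \<le> e / 2"
    using e(1) by (intro mdist_cfunspace_le) (auto simp: dist_real_def)
  then have "?K \<in> mball_of ?m M e"
    using kernels[OF MV] kernels[OF K] e(1) by (simp del: mspace_cfunspace)
  then have "?K \<in> COP V" using e(2) T(3) K by blast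
  with e(1) show thesis using that[of "e / 2"] by simp
qed

lemma interior_COP_subset_C_cone:
  assumes V: "compact V"
  shows "kernel_topology V interior_of COP V \<subseteq> (\<Union>r. C_cone V r)"
proof
  fix M assume int: "M \<in> kernel_topology V interior_of COP V"
  then obtain e where e: "e > 0" "(\<lambda>p\<in>V \<times> V. M p - e) \<in> COP V"
    using interior_COP_shift[OF V] by metis
  have M: "M \<in> kernels V" using interior_of_subset[of "kernel_topology V" "COP V"] int by (auto simp: COP_def)
  have "compact (M ` (V \<times> V))"
    using M V by (intro compact_continuous_image compact_Times) (auto simp: kernels_def)
  then have "bounded (M ` (V \<times> V))" by (rule compact_imp_bounded)
  then obtain B where B: "\<And>p. p \<in> V \<times> V \<Longrightarrow> \<bar>M p\<bar> \<le> B"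
    unfolding bounded_iff by (metis imageI real_norm_def)
  \<comment> \<open>Makes each diagonal value at most \<open>real d * e\<close>, so the
    \<open>d\<close> of them cannot exceed the lower bound \<open>real d * (real d * e)\<close> for
    the full double sum.\<close>
  obtain r :: nat where r: "B \<le> e * real r"
    using reals_Archimedean3[OF e(1), rule_format, of B] by (metis less_imp_le mult.commute)
  define d where "d = r + 2"
  let ?P = "{p \<in> {..<d} \<times> {..<d}. fst p \<noteq> snd p}"
  \<comment> \<open>The witness for \<open>N\<close> is the symmetrized tensor itself; by
    idempotence only its nonnegativity has to be shown.\<close>
  let ?T = "symmetrize V d (stack V 2 r (kernel_tensor V M))"
  have "0 \<le> ?T v" if v: "v \<in> tuples V d" for v
  proof -
    have vV: "v ` {..<d} \<subseteq> V" using v by (auto simp: tuples_def)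
    have "0 \<le> (\<Sum>i<d. \<Sum>j<d. (\<lambda>p\<in>V \<times> V. M p - e) (v i, v j))"
      by (rule COP_sum_tuple_nonneg[OF e(2) vV])
    also have "\<dots> = (\<Sum>i<d. \<Sum>j<d. M (v i, v j) - e)"
      using vV by (intro sum.cong refl) auto
    also have "\<dots> = (\<Sum>i<d. \<Sum>j<d. M (v i, v j)) - real d * (real d * e)"
      by (simp add: sum_subtractf)
    finally have full: "real d * (real d * e) \<le> (\<Sum>i<d. \<Sum>j<d. M (v i, v j))" by simp
    have "(\<Sum>i<d. M (v i, v i)) \<le> (\<Sum>i<d. real d * e)"
    proof (rule sum_mono)
      fix i assume "i \<in> {..<d}"
      then have "M (v i, v i) \<le> B" using B[of "(v i, v i)"] vV by auto
      also have "B \<le> real d * e" using r e(1) by (simp add: d_def algebra_simps)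
      finally show "M (v i, v i) \<le> real d * e" .
    qed
    then have diag: "(\<Sum>i<d. M (v i, v i)) \<le> real d * (real d * e)" by simp
    \<comment> \<open>Permutations send \<open>0\<close> and \<open>1\<close> to distinct positions,
      so the symmetrization sees the double sum without its diagonal.\<close>
    have "(\<Sum>i<d. \<Sum>j<d. M (v i, v j)) = (\<Sum>(i, j) \<in> {..<d} \<times> {..<d}. M (v i, v j))"
      by (simp add: sum.cartesian_product)
    also have "{..<d} \<times> {..<d} = ?P \<union> (\<lambda>i. (i, i)) ` {..<d}" by auto
    also have "(\<Sum>(i, j) \<in> \<dots>. M (v i, v j)) = (\<Sum>(i, j) \<in> ?P. M (v i, v j)) + (\<Sum>i<d. M (v i, v i))"
      by (subst sum.union_disjoint) (auto simp: sum.reindex inj_on_def)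
    finally have "0 \<le> (\<Sum>(i, j) \<in> ?P. M (v i, v j))" using full diag by linarith
    then have "0 \<le> real (card ?P) * (\<Sum>\<pi> | \<pi> permutes {..<d}. M (v (\<pi> 0), v (\<pi> 1)))"
      unfolding sum_permutes_pair[of d "\<lambda>i j. M (v i, v j)"] by simp
    \<comment> \<open>Since \<open>d\<close> is at least 2, the number of pairs is positive and can
      be cancelled.\<close>
    moreover have "(0, 1) \<in> ?P" by (simp add: d_def)
    then have "?P \<noteq> {}" by (metis empty_iff)
    then have "card ?P > 0" unfolding card_gt_0_iff by (rule conjI) simp
    ultimately have "0 \<le> (\<Sum>\<pi> | \<pi> permutes {..<d}. M (v (\<pi> 0), v (\<pi> 1)))"
      using mult_left_le_imp_le[of "real (card ?P)" 0] by (simp only: mult_zero_right of_nat_0_less_iff)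
    also have "\<dots> = (\<Sum>\<pi> | \<pi> permutes {..<d}. stack V 2 r (kernel_tensor V M) (v \<circ> \<pi>))"
      using tuples_comp_permutes[OF v] by (intro sum.cong refl) (simp add: stack_kernel_tensor d_def)
    finally show ?thesis using v by (simp add: symmetrize_def)
  qed
  then have "?T \<in> nonneg_tensors V (r + 2)"
    by (simp add: nonneg_tensors_def tensors_def symmetrize_def d_def)
  moreover have "symmetrize V (r + 2) ?T = symmetrize V (r + 2) (stack V 2 r (kernel_tensor V M))"
    by (simp add: symmetrize_symmetrize d_def)
  ultimately have "M \<in> C_cone V r" using M unfolding C_cone_def by (auto intro: bexI[of _ ?T])
  then show "M \<in> (\<Union>r. C_cone V r)" by blast
qed

theorem theorem1:
  fixes V :: "(real ^ 'n) set"
  assumes "compact V"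
  shows "(\<forall>r. C_cone V r \<subseteq> C_cone V (Suc r)) \<and> (\<forall>r. C_cone V r \<subseteq> COP V) \<and>
         (\<forall>r. Q_cone V r \<subseteq> Q_cone V (Suc r)) \<and> (\<forall>r. Q_cone V r \<subseteq> COP V) \<and>
         kernel_topology V interior_of COP V \<subseteq> (\<Union>r. C_cone V r) \<and>
         (\<Union>r. C_cone V r) \<subseteq> (\<Union>r. Q_cone V r)"
  by (intro conjI allI UN_mono subset_refl C_cone_Suc Q_cone_Suc Q_cone_subset_COP
      C_cone_subset_Q_cone order_trans[OF C_cone_subset_Q_cone Q_cone_subset_COP]
      interior_COP_subset_C_cone assms)

end
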